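(* Let $E$ be a directed graph. The connected components of the topological space $E^0$, endowed with the DCC topology, are exactly the equivalence classes of $E^0$ for the equivalence relation $\equiv$.
   Context: A directed graph $E=(E^0,E^1,r,s)$ consists of two disjoint sets $E^0$ (vertices) and $E^1$ (edges) and maps $r,s:E^1\to E^0$ (range and source). A path of length $m$ is a finite chain of edges $f_1\cdots f_m$ with $r(f_i)=s(f_{i+1})$; it goes from $s(f_1)$ to $r(f_m)$. Vertices are considered as (trivial) paths of length $0$. Write $u\ge v$ if there is a path from $u$ to $v$, and for $S\subseteq E^0$ write $u\ge S$ if $u\ge v$ for some $v\in S$. DCC topology: for $S\subseteq E^0$ put $c(S)=\{v\in E^0: v\ge S\}$. The map $c$ is a Kuratowski closure operator on $E^0$, and the DCC topology is the topology whose closed sets are those $S\subseteq E^0$ with $S=c(S)$. Relation $\equiv$: for $u\in E^0$ write $u\overset{0}{\equiv}u$; for $u,v\in E^0$ write $u\overset{1}{\equiv}v$ if there is $f\in E^1$ with either $s(f)=u$, $r(f)=v$, or $s(f)=v$, $r(f)=u$. Then $u\equiv v$ means that there are vertices $u=u_1,u_2,\dots,u_n=v$ such that any two consecutive ones are related by $\overset{0}{\equiv}$ or $\overset{1}{\equiv}$. *)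

theory Defs
  imports "HOL-Analysis.Abstract_Topological_Spaces" "Graph_Theory.Arc_Walk"
begin

text \<open>
  A directed graph \<open>(E\<^sup>0, E\<^sup>1, r, s)\<close> is a \<^locale>\<open>wf_digraph\<close> with \<open>E\<^sup>0 = verts G\<close>,
  \<open>E\<^sup>1 = arcs G\<close>, \<open>s = tail G\<close> and \<open>r = head G\<close>; loops, multiple arcs and infinitely many
  vertices or arcs are allowed. Vertices and arcs live in different types, so they are disjoint.
  Paths are library walks \<open>awalk u p v\<close>, with the trivial path at a vertex given by \<open>p = []\<close>.
\<close>

definition conn_to :: "('a, 'b) pre_digraph \<Rightarrow> 'a \<Rightarrow> 'a \<Rightarrow> bool" where
  "conn_to G u v \<longleftrightarrow> (\<exists>p. pre_digraph.awalk G u p v)"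

definition conn_to_set :: "('a, 'b) pre_digraph \<Rightarrow> 'a \<Rightarrow> 'a set \<Rightarrow> bool" where
  "conn_to_set G u S \<longleftrightarrow> (\<exists>v\<in>S. conn_to G u v)"

definition dcc_closure :: "('a, 'b) pre_digraph \<Rightarrow> 'a set \<Rightarrow> 'a set" where
  "dcc_closure G S = {v \<in> verts G. conn_to_set G v S}"

text \<open>
  The library presents a topology by its open sets; the characterisation by closed sets is
  \<open>closedin_dcc_topology\<close> below.
\<close>

definition dcc_topology :: "('a, 'b) pre_digraph \<Rightarrow> 'a topology" where
  "dcc_topology G =
     topology (\<lambda>U. U \<subseteq> verts G \<and> dcc_closure G (verts G - U) = verts G - U)"

definition vequiv0 :: "('a, 'b) pre_digraph \<Rightarrow> 'a \<Rightarrow> 'a \<Rightarrow> bool" where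
  "vequiv0 G u v \<longleftrightarrow> u \<in> verts G \<and> u = v"

definition vequiv1 :: "('a, 'b) pre_digraph \<Rightarrow> 'a \<Rightarrow> 'a \<Rightarrow> bool" where
  "vequiv1 G u v \<longleftrightarrow> u \<in> verts G \<and> v \<in> verts G \<and>
     (\<exists>f\<in>arcs G. tail G f = u \<and> head G f = v \<or> tail G f = v \<and> head G f = u)"

definition vequiv :: "('a, 'b) pre_digraph \<Rightarrow> ('a \<times> 'a) set" where
  "vequiv G = {(u, v). \<exists>us. us \<noteq> [] \<and> set us \<subseteq> verts G \<and> hd us = u \<and> last us = v \<and>
     successively (\<lambda>x y. vequiv0 G x y \<or> vequiv1 G x y) us}"

context wf_digraph
begin

lemma conn_to_refl: "v \<in> verts G \<Longrightarrow> conn_to G v v"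
  unfolding conn_to_def by (rule exI[of _ "[]"]) (simp add: awalk_def)

lemma dcc_closed_iff:
  assumes "S \<subseteq> verts G"
  shows "dcc_closure G S = S \<longleftrightarrow> (\<forall>u\<in>verts G. \<forall>v\<in>S. conn_to G u v \<longrightarrow> u \<in> S)"
  using assms conn_to_refl unfolding dcc_closure_def conn_to_set_def by blast

lemma istopology_dcc:
  "istopology (\<lambda>U. U \<subseteq> verts G \<and> dcc_closure G (verts G - U) = verts G - U)"
proof -
  have "(U \<subseteq> verts G \<and> dcc_closure G (verts G - U) = verts G - U) \<longleftrightarrow>
        U \<subseteq> verts G \<and> (\<forall>u\<in>U. \<forall>v\<in>verts G. conn_to G u v \<longrightarrow> v \<in> U)" for U
    unfolding dcc_closed_iff[OF Diff_subset] by blast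
  then show ?thesis
    unfolding istopology_def by (simp only:) blast
qed

lemma openin_dcc_topology:
  "openin (dcc_topology G) U \<longleftrightarrow> U \<subseteq> verts G \<and> dcc_closure G (verts G - U) = verts G - U"
  unfolding dcc_topology_def topology_inverse'[OF istopology_dcc] by (rule refl)

lemma topspace_dcc_topology [simp]: "topspace (dcc_topology G) = verts G"
proof -
  have "openin (dcc_topology G) (verts G)"
    by (simp add: openin_dcc_topology dcc_closure_def conn_to_set_def)
  then have "verts G \<subseteq> topspace (dcc_topology G)"
    by (rule openin_subset)
  moreover have "topspace (dcc_topology G) \<subseteq> verts G"
    using openin_topspace[of "dcc_topology G"] unfolding openin_dcc_topology by (rule conjunct1)
  ultimately show ?thesis
    by simp
qed

lemma closedin_dcc_topology:
  "closedin (dcc_topology G) S \<longleftrightarrow> S \<subseteq> verts G \<and> S = dcc_closure G S"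
proof (cases "S \<subseteq> verts G")
  case True
  then have "verts G - (verts G - S) = S"
    by (simp add: double_diff)
  with True show ?thesis
    by (simp add: closedin_def openin_dcc_topology eq_commute[of S])
qed (simp add: closedin_def)

lemma equiv_vequiv: "equiv (verts G) (vequiv G)"
proof -
  define R where "R = (\<lambda>x y. vequiv0 G x y \<or> vequiv1 G x y)"
  have R_sym: "R y x = R x y" for x y
    unfolding R_def vequiv0_def vequiv1_def by auto
  have R_refl: "R x x" if "x \<in> verts G" for x
    using that unfolding R_def vequiv0_def by simp
  have vequiv_iff: "(u, v) \<in> vequiv G \<longleftrightarrow>
      (\<exists>us. us \<noteq> [] \<and> set us \<subseteq> verts G \<and> hd us = u \<and> last us = v \<and> successively R us)" for u v
    unfolding vequiv_def R_def by simp
  have in_verts: "u \<in> verts G \<and> v \<in> verts G" if uv: "(u, v) \<in> vequiv G" for u v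
  proof -
    obtain us where us: "us \<noteq> []" "set us \<subseteq> verts G" "hd us = u" "last us = v"
      using uv unfolding vequiv_iff by blast
    show ?thesis
      using hd_in_set[OF us(1)] last_in_set[OF us(1)] us(2) unfolding us(3,4) by blast
  qed
  show ?thesis
  proof (rule equivI)
    show "vequiv G \<subseteq> verts G \<times> verts G"
      using in_verts by (intro subrelI) simp
    show "refl_on (verts G) (vequiv G)"
    proof (rule refl_onI)
      fix x assume "x \<in> verts G"
      then show "(x, x) \<in> vequiv G"
        unfolding vequiv_iff by (intro exI[of _ "[x]"]) simp
    qed
    show "sym (vequiv G)"
    proof (rule symI)
      fix x y assume "(x, y) \<in> vequiv G"
      then obtain us where "us \<noteq> []" "set us \<subseteq> verts G" "hd us = x" "last us = y" "successively R us"
        unfolding vequiv_iff by blast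
      then show "(y, x) \<in> vequiv G"
        unfolding vequiv_iff
        by (intro exI[of _ "rev us"]) (simp add: hd_rev last_rev successively_rev R_sym)
    qed
    show "trans (vequiv G)"
    proof (rule transI)
      fix x y z assume xy: "(x, y) \<in> vequiv G" and yz: "(y, z) \<in> vequiv G"
      obtain us where us: "us \<noteq> []" "set us \<subseteq> verts G" "hd us = x" "last us = y" "successively R us"
        using xy unfolding vequiv_iff by blast
      obtain vs where vs: "vs \<noteq> []" "set vs \<subseteq> verts G" "hd vs = y" "last vs = z" "successively R vs"
        using yz unfolding vequiv_iff by blast
      have "R y y"
        using in_verts[OF xy] R_refl by blast
      then show "(x, z) \<in> vequiv G"
        unfolding vequiv_iff using us vs
        by (intro exI[of _ "us @ vs"]) (simp add: successively_append_iff)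
    qed
  qed
qed

end

end

theory Submission
  imports Defs
begin

text \<open>
  In the DCC topology a set is closed when it is stable under passing to predecessors, so it is
  clopen exactly when it is stable along the arcs in both directions. Every class of
  \<open>\<equiv>\<close> is therefore clopen, and a connected set that meets it lies inside it
  (\<open>connected_subset_vequiv_class\<close>). Conversely, the tail of an arc lies in the closure of its
  head, so the two ends of an arc form a connected set (\<open>connectedin_arc_ends\<close>), and a chain of
  arcs stays within one connected component. Hence lying in a common connected
  set and being related by \<open>\<equiv>\<close> are the same relation on the vertices.
\<close>

context wf_digraph
begin

lemma vequiv_subset_verts: "(u, v) \<in> vequiv G \<Longrightarrow> u \<in> verts G \<and> v \<in> verts G"
  using equivE[OF equiv_vequiv] by blast

lemma arc_imp_vequiv:
  assumes "f \<in> arcs G"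
  shows "(tail G f, head G f) \<in> vequiv G"
proof -
  have "successively (\<lambda>x y. vequiv0 G x y \<or> vequiv1 G x y) [tail G f, head G f]"
    using assms wellformed[OF assms] unfolding vequiv1_def by auto
  then show ?thesis
    unfolding vequiv_def using wellformed[OF assms]
    by (intro CollectI case_prodI exI[of _ "[tail G f, head G f]"]) simp
qed

lemma conn_to_imp_vequiv:
  assumes "conn_to G u v"
  shows "(u, v) \<in> vequiv G"
proof -
  have trans: "trans (vequiv G)" and refl: "refl_on (verts G) (vequiv G)"
    using equiv_vequiv by (auto elim: equivE)
  obtain p where "awalk u p v"
    using assms unfolding conn_to_def by blast
  then show ?thesis
  proof (induction p arbitrary: u)
    case Nil
    then show ?case
      using refl by (auto simp: awalk_Nil_iff dest: refl_onD)
  next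
    case (Cons f p)
    then have f: "f \<in> arcs G" "u = tail G f" and "awalk (head G f) p v"
      by (auto simp: awalk_Cons_iff)
    then show ?case
      using Cons.IH arc_imp_vequiv transD[OF trans] by metis
  qed
qed

text \<open>
  A path in either direction keeps a vertex in its class, so both the class and its complement are
  stable under predecessors.
\<close>

lemma vequiv_class_clopen:
  "closedin (dcc_topology G) (vequiv G `` {u}) \<and> openin (dcc_topology G) (vequiv G `` {u})"
proof -
  let ?C = "vequiv G `` {u}"
  have trans: "trans (vequiv G)" and sym: "sym (vequiv G)"
    using equiv_vequiv by (auto elim: equivE)
  have sub: "?C \<subseteq> verts G"
    using vequiv_subset_verts by blast
  have same: "x \<in> ?C \<longleftrightarrow> y \<in> ?C" if "conn_to G x y" for x y
    using conn_to_imp_vequiv[OF that] transD[OF trans] symD[OF sym] by blast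
  have "dcc_closure G ?C = ?C"
    unfolding dcc_closed_iff[OF sub] using same by blast
  moreover have "dcc_closure G (verts G - ?C) = verts G - ?C"
    unfolding dcc_closed_iff[OF Diff_subset] using same by blast
  ultimately show ?thesis
    using sub by (simp add: closedin_dcc_topology openin_dcc_topology)
qed

lemma connected_subset_vequiv_class:
  assumes "connectedin (dcc_topology G) T" and "u \<in> T"
  shows "T \<subseteq> vequiv G `` {u}"
proof -
  have "u \<in> verts G"
    using connectedin_subset_topspace[OF assms(1)] assms(2) by auto
  then have "u \<in> vequiv G `` {u}"
    using equiv_class_self[OF equiv_vequiv] by blast
  then show ?thesis
    using connectedin_clopen_cases[OF assms(1), of "vequiv G `` {u}"] vequiv_class_clopen assms(2)
    by (auto simp: disjnt_iff)
qed

text \<open>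
  The set lies between the connected singleton of the head and the closure of that singleton.
\<close>

lemma connectedin_arc_ends:
  assumes "f \<in> arcs G"
  shows "connectedin (dcc_topology G) {tail G f, head G f}"
proof (rule connectedin_intermediate_closure_of)
  let ?X = "dcc_topology G"
  have ends: "tail G f \<in> verts G" "head G f \<in> verts G"
    using wellformed[OF assms] by auto
  have step: "conn_to G (tail G f) (head G f)"
    unfolding conn_to_def using arc_implies_awalk[OF assms] by blast
  show "connectedin ?X {head G f}"
    using ends by simp
  show "{head G f} \<subseteq> {tail G f, head G f}"
    by simp
  have head: "head G f \<in> ?X closure_of {head G f}"
    using closure_of_subset[of "{head G f}" ?X] ends by simp
  have "dcc_closure G (?X closure_of {head G f}) = ?X closure_of {head G f}"
    using closedin_closure_of[of ?X "{head G f}"] unfolding closedin_dcc_topology by simp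
  with head step ends have "tail G f \<in> ?X closure_of {head G f}"
    unfolding dcc_closure_def conn_to_set_def by blast
  with head show "{tail G f, head G f} \<subseteq> ?X closure_of {head G f}"
    by simp
qed

lemma vequiv_imp_connected_component:
  assumes "(u, v) \<in> vequiv G"
  shows "connected_component_of (dcc_topology G) u v"
proof -
  let ?K = "connected_component_of (dcc_topology G)"
  have link: "?K x y" if "vequiv0 G x y \<or> vequiv1 G x y" for x y
    using that
  proof
    assume "vequiv0 G x y"
    then show ?thesis
      by (auto simp: vequiv0_def connected_component_of_refl)
  next
    assume "vequiv1 G x y"
    then obtain f where "f \<in> arcs G" "{x, y} = {tail G f, head G f}"
      unfolding vequiv1_def by blast
    then show ?thesis
      using connectedin_arc_ends unfolding connected_component_of_def by (metis insertCI)
  qed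
  obtain us where "us \<noteq> []" "set us \<subseteq> verts G" "hd us = u" "last us = v"
    and "successively (\<lambda>x y. vequiv0 G x y \<or> vequiv1 G x y) us"
    using assms unfolding vequiv_def by blast
  then show ?thesis
  proof (induction us arbitrary: u rule: list_nonempty_induct)
    case (single x)
    then show ?case
      by (simp add: connected_component_of_refl)
  next
    case (cons x us)
    from cons.prems cons.hyps have "vequiv0 G x (hd us) \<or> vequiv1 G x (hd us)"
      by (simp add: successively_Cons)
    then have "?K x (hd us)"
      by (rule link)
    moreover have "?K (hd us) v"
      using cons by (auto simp: successively_Cons)
    ultimately show ?case
      using cons.prems connected_component_of_trans by force
  qed
qed

lemma connected_component_of_dcc_iff:
  "connected_component_of (dcc_topology G) u v \<longleftrightarrow> (u, v) \<in> vequiv G"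
proof
  assume "connected_component_of (dcc_topology G) u v"
  then show "(u, v) \<in> vequiv G"
    using connected_subset_vequiv_class unfolding connected_component_of_def by blast
qed (rule vequiv_imp_connected_component)

end

theorem proposition2p2:
  fixes G :: "('a, 'b) pre_digraph"
  assumes "wf_digraph G"
  shows "connected_components_of (dcc_topology G) = verts G // vequiv G"
proof -
  interpret wf_digraph G by fact
  show ?thesis
    unfolding connected_components_of_def quotient_def
    by (auto simp: connected_component_of_dcc_iff Image_singleton)
qed

end
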